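(* For a property $\mathcal{P}$ (a set of finite graphs), the following are equivalent: (A) $\mathcal{P}$ is indiscompositive; (B) $\mathcal{P}$ has a generating set, and moreover, for any graph $L\in\mathcal{P}$ and any generating set $\mathcal{G}$ of $\mathcal{P}$, the set $\mathcal{G}[2\circledast L]$ is also a generating set of $\mathcal{P}$; (C) $\mathcal{P}$ has an ordered generating set $G_1\le G_2\le\cdots$ such that every $G_i$ contains two disjoint copies of $G_{i-1}$ (i.e. contains, as an induced subgraph, some graph in $2\circledast G_{i-1}$); (D) $\mathcal{P}$ has a generating graph $H$ that contains two disjoint copies of itself, i.e. $H$ has an induced subgraph belonging to $2\circledast H$; and moreover, for any countable generating graph $G$ of $\mathcal{P}$ there is a generating graph $H\ge G$ of $\mathcal{P}$ that contains two disjoint copies of itself.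
   Context: Graphs in properties are finite, simple and unlabelled; generating graphs may be infinite. $G\le H$ means $G$ is (isomorphic to) an induced subgraph of $H$. A property $\mathcal{P}$ is induced-hereditary if it is closed under induced subgraphs. $\mathcal{P}$ is indiscompositive (induced-hereditary disjoint compositive) if it is induced-hereditary and for every $G,H\in\mathcal{P}$ there is a graph $K\in\mathcal{P}$ containing $G$ and $H$ as vertex-disjoint induced subgraphs. A generating set for $\mathcal{P}$ is a set $\mathcal{G}\subseteq\mathcal{P}$ such that every graph in $\mathcal{P}$ is an induced subgraph of some member of $\mathcal{G}$; it is ordered if its elements can be listed (finitely or infinitely) as $G_1\le G_2\le\cdots$. A generating graph for $\mathcal{P}$ is a (finite or infinite) graph $H$ such that $\mathcal{P}=\{G \mid G\le H,\ |V(G)|\text{ finite}\}$. For a graph $L$, $2\circledast L$ is the set of all graphs consisting of two vertex-disjoint copies of $L$ with arbitrary edges added between the two copies. For a set $\mathcal{G}$ of graphs, $\mathcal{G}[2\circledast L]$ is the set of graphs in $\mathcal{G}$ that contain, as an induced subgraph, some graph in $2\circledast L$.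
   Formalization: A generating set must also have all induced subgraphs of its members in P (else P={K_{2^n}} satisfies (B),(C) but not (A)); the list in (C) is infinite, repetitions allowed (else P={K_0,K_1} is a counterexample); and P is non-empty (the empty property satisfies (A) but not (D)). *)

theory Defs
  imports "HOL-Library.Countable_Set"
begin

text \<open>
  Graphs are pairs of a vertex set and a set of two-element edges; the vertex set may be empty
  or infinite.
\<close>

type_synonym 'a graph = "'a set \<times> 'a set set"

abbreviation verts :: "'a graph \<Rightarrow> 'a set" where
  "verts G \<equiv> fst G"

abbreviation edges :: "'a graph \<Rightarrow> 'a set set" where
  "edges G \<equiv> snd G"

definition simple_graph :: "'a graph \<Rightarrow> bool" where
  "simple_graph G \<longleftrightarrow> (\<forall>e\<in>edges G. e \<subseteq> verts G \<and> card e = 2)"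

definition fin_graph :: "'a graph \<Rightarrow> bool" where
  "fin_graph G \<longleftrightarrow> simple_graph G \<and> finite (verts G)"

definition graph_iso :: "'a graph \<Rightarrow> 'b graph \<Rightarrow> bool" (infix "\<cong>\<^sub>g" 50) where
  "G \<cong>\<^sub>g H \<longleftrightarrow>
     (\<exists>f. bij_betw f (verts G) (verts H) \<and>
          (\<forall>x\<in>verts G. \<forall>y\<in>verts G. {x, y} \<in> edges G \<longleftrightarrow> {f x, f y} \<in> edges H))"

definition induced :: "'a graph \<Rightarrow> 'a set \<Rightarrow> 'a graph" where
  "induced G A = (A, {e \<in> edges G. e \<subseteq> A})"

definition induced_sub :: "'a graph \<Rightarrow> 'b graph \<Rightarrow> bool" (infix "\<le>\<^sub>g" 50) where
  "G \<le>\<^sub>g H \<longleftrightarrow> (\<exists>A \<subseteq> verts H. G \<cong>\<^sub>g induced H A)"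

text \<open>
  Sets of unlabelled finite graphs are represented by isomorphism-closed sets of finite graphs
  with vertices in \<^typ>\<open>nat\<close>. A property is non-empty: a generating graph always generates at
  least the graph without vertices.
\<close>

definition graph_property :: "nat graph set \<Rightarrow> bool" where
  "graph_property P \<longleftrightarrow>
     P \<noteq> {} \<and> (\<forall>G\<in>P. fin_graph G) \<and> (\<forall>G\<in>P. \<forall>H. simple_graph H \<and> G \<cong>\<^sub>g H \<longrightarrow> H \<in> P)"

definition induced_hereditary :: "nat graph set \<Rightarrow> bool" where
  "induced_hereditary P \<longleftrightarrow> (\<forall>H\<in>P. \<forall>G. fin_graph G \<and> G \<le>\<^sub>g H \<longrightarrow> G \<in> P)"

definition contains_disjoint :: "'a graph \<Rightarrow> 'b graph \<Rightarrow> 'c graph \<Rightarrow> bool" where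
  "contains_disjoint K G H \<longleftrightarrow>
     (\<exists>A B. A \<subseteq> verts K \<and> B \<subseteq> verts K \<and> A \<inter> B = {} \<and> G \<cong>\<^sub>g induced K A \<and> H \<cong>\<^sub>g induced K B)"

definition indiscompositive :: "nat graph set \<Rightarrow> bool" where
  "indiscompositive P \<longleftrightarrow>
     induced_hereditary P \<and> (\<forall>G\<in>P. \<forall>H\<in>P. \<exists>K\<in>P. contains_disjoint K G H)"

text \<open>
  A generating set determines the property as the set of all induced subgraphs of its members.
  For induced-hereditary properties the last conjunct is redundant, see
  \<open>generating_set_hereditary\<close>; without it every set of graphs would be a generating set of itself.
\<close>

definition generating_set :: "nat graph set \<Rightarrow> nat graph set \<Rightarrow> bool" where
  "generating_set P \<G> \<longleftrightarrow>
     \<G> \<subseteq> P \<and> (\<forall>G\<in>P. \<exists>K\<in>\<G>. G \<le>\<^sub>g K) \<and> (\<forall>K\<in>\<G>. \<forall>G. fin_graph G \<and> G \<le>\<^sub>g K \<longrightarrow> G \<in> P)"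

lemma generating_set_hereditary:
  assumes "induced_hereditary P"
  shows "generating_set P \<G> \<longleftrightarrow> \<G> \<subseteq> P \<and> (\<forall>G\<in>P. \<exists>K\<in>\<G>. G \<le>\<^sub>g K)"
  using assms unfolding generating_set_def induced_hereditary_def by blast

definition generating_graph :: "nat graph set \<Rightarrow> 'a graph \<Rightarrow> bool" where
  "generating_graph P H \<longleftrightarrow> simple_graph H \<and> P = {G. fin_graph G \<and> G \<le>\<^sub>g H}"

definition two_copies :: "'a graph \<Rightarrow> 'a graph set" ("2\<circledast> _" [90] 90) where
  "2\<circledast> L =
     {M. simple_graph M \<and>
         (\<exists>A B. verts M = A \<union> B \<and> A \<inter> B = {} \<and> L \<cong>\<^sub>g induced M A \<and> L \<cong>\<^sub>g induced M B)}"

definition containing_some :: "'a graph set \<Rightarrow> 'a graph set \<Rightarrow> 'a graph set" where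
  "containing_some \<G> \<M> = {K \<in> \<G>. \<exists>M\<in>\<M>. M \<le>\<^sub>g K}"

end

theory Submission
  imports Defs "HOL-Library.Diagonal_Subsequence" "HOL-Library.Disjoint_Sets"
    "HOL-Library.Ramsey"
begin

text \<open>
  The hard part is to find, for a countable generating graph \<open>U\<close> of an indiscompositive property,
  a generating graph above \<open>U\<close> that contains two disjoint copies of itself. A naive iterated
  doubling of \<open>U\<close> has no reason to do so, since the embeddings of successive stages need not be
  coherent. Instead one takes copies of \<open>U\<close>, indexed by the natural numbers, such that for \<open>i < j\<close>
  the adjacency of \<open>(s, i)\<close> and \<open>(t, j)\<close> depends on \<open>s\<close> and \<open>t\<close> only. Then any two strictly
  increasing index maps with disjoint ranges, such as \<open>i \<mapsto> 2 i\<close> and \<open>i \<mapsto> 2 i + 1\<close>, give two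
  disjoint copies. To choose the adjacency so that no new finite induced subgraphs arise, place
  pairwise disjoint copies of larger and larger finite parts of \<open>U\<close> inside \<open>U\<close>. By Ramsey's theorem
  and a diagonal argument, on some subsequence it is true that for each \<open>s\<close> and \<open>t\<close> the adjacency
  between the \<open>i\<close>-th copy of \<open>s\<close> and the \<open>j\<close>-th copy of \<open>t\<close> is the same for all large \<open>i < j\<close>.
\<close>

declare split_paired_All [simp del] split_paired_Ex [simp del]

subsection \<open>Embeddings\<close>

definition embedding :: "('a \<Rightarrow> 'b) \<Rightarrow> 'a graph \<Rightarrow> 'b graph \<Rightarrow> bool" where
  "embedding f G H \<longleftrightarrow> inj_on f (verts G) \<and> f ` verts G \<subseteq> verts H \<and>
     (\<forall>x\<in>verts G. \<forall>y\<in>verts G. {x, y} \<in> edges G \<longleftrightarrow> {f x, f y} \<in> edges H)"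

lemma embedding_inj_on: "embedding f G H \<Longrightarrow> inj_on f (verts G)"
  by (simp add: embedding_def)

lemma embedding_image_subset: "embedding f G H \<Longrightarrow> f ` verts G \<subseteq> verts H"
  by (simp add: embedding_def)

lemma embedding_edge_iff:
  "embedding f G H \<Longrightarrow> x \<in> verts G \<Longrightarrow> y \<in> verts G \<Longrightarrow> {f x, f y} \<in> edges H \<longleftrightarrow> {x, y} \<in> edges G"
  by (simp add: embedding_def)

lemma embedding_image_disjoint:
  "embedding f G H \<Longrightarrow> A \<subseteq> verts G \<Longrightarrow> B \<subseteq> verts G \<Longrightarrow> A \<inter> B = {} \<Longrightarrow> f ` A \<inter> f ` B = {}"
  by (metis embedding_inj_on image_empty inj_on_image_Int)

lemma embedding_id: "embedding id G G"
  by (simp add: embedding_def)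

lemma embedding_id_iff:
  "embedding id G H \<longleftrightarrow> verts G \<subseteq> verts H \<and>
     (\<forall>x\<in>verts G. \<forall>y\<in>verts G. {x, y} \<in> edges G \<longleftrightarrow> {x, y} \<in> edges H)"
  by (simp add: embedding_def)

lemma embedding_cong: "embedding f G H \<Longrightarrow> (\<And>x. x \<in> verts G \<Longrightarrow> f x = g x) \<Longrightarrow> embedding g G H"
  unfolding embedding_def by (simp cong: inj_on_cong image_cong)

lemma embedding_comp:
  assumes f: "embedding f G H" and g: "embedding g H K"
  shows "embedding (g \<circ> f) G K"
  unfolding embedding_def
proof (intro conjI ballI)
  show "inj_on (g \<circ> f) (verts G)"
    using f g by (auto simp: embedding_def intro: comp_inj_on inj_on_subset)
  show "(g \<circ> f) ` verts G \<subseteq> verts K"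
    using f g by (fastforce simp: embedding_def)
  fix x y assume xy: "x \<in> verts G" "y \<in> verts G"
  then have "f x \<in> verts H" "f y \<in> verts H"
    using embedding_image_subset[OF f] by auto
  then show "{x, y} \<in> edges G \<longleftrightarrow> {(g \<circ> f) x, (g \<circ> f) y} \<in> edges K"
    using xy by (simp add: embedding_edge_iff[OF f] embedding_edge_iff[OF g])
qed

lemma embedding_id_trans: "embedding id G H \<Longrightarrow> embedding id H K \<Longrightarrow> embedding id G K"
  using embedding_comp[of id G H id K] by simp

lemma embedding_inv_into:
  assumes f: "embedding f G H" and onto: "f ` verts G = verts H"
  shows "embedding (inv_into (verts G) f) H G"
  unfolding embedding_def
proof (intro conjI ballI)
  fix u v assume "u \<in> verts H" "v \<in> verts H"
  then obtain x y where "x \<in> verts G" "y \<in> verts G" "u = f x" "v = f y"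
    using onto by blast
  then show "{u, v} \<in> edges H \<longleftrightarrow>
      {inv_into (verts G) f u, inv_into (verts G) f v} \<in> edges G"
    using embedding_edge_iff[OF f] embedding_inj_on[OF f] by simp
qed (use onto in \<open>auto simp: inj_on_inv_into inv_into_into\<close>)

lemma graph_iso_iff: "G \<cong>\<^sub>g H \<longleftrightarrow> (\<exists>f. embedding f G H \<and> f ` verts G = verts H)"
  unfolding graph_iso_def embedding_def bij_betw_def by blast

lemma verts_induced [simp]: "verts (induced G A) = A"
  by (simp add: induced_def)

lemma induced_induced: "A \<subseteq> B \<Longrightarrow> induced (induced G B) A = induced G A"
  by (auto simp: induced_def)

lemma simple_graph_induced: "simple_graph G \<Longrightarrow> simple_graph (induced G A)"
  by (simp add: simple_graph_def induced_def)

lemma embedding_id_induced: "A \<subseteq> verts G \<Longrightarrow> embedding id (induced G A) G"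
  by (auto simp: embedding_def induced_def)

lemma embedding_induced_mono:
  "embedding f (induced G B) H \<Longrightarrow> A \<subseteq> B \<Longrightarrow> embedding f (induced G A) H"
  unfolding embedding_def induced_def by (auto simp: subset_iff intro: inj_on_subset)

lemma embedding_restrict_codomain:
  "embedding id K H \<Longrightarrow> embedding f G H \<Longrightarrow> f ` verts G \<subseteq> verts K \<Longrightarrow> embedding f G K"
  by (simp add: embedding_def image_subset_iff)

lemma embedding_into_induced_iff:
  assumes "A \<subseteq> verts H"
  shows "embedding f G (induced H A) \<longleftrightarrow> embedding f G H \<and> f ` verts G \<subseteq> A"
proof
  assume f: "embedding f G (induced H A)"
  then show "embedding f G H \<and> f ` verts G \<subseteq> A"
    using embedding_comp[OF f embedding_id_induced[OF assms]] embedding_image_subset[OF f] by simp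
next
  assume "embedding f G H \<and> f ` verts G \<subseteq> A"
  then show "embedding f G (induced H A)"
    by (intro embedding_restrict_codomain[OF embedding_id_induced[OF assms]]) simp_all
qed

lemma graph_iso_induced_iff:
  assumes "A \<subseteq> verts H"
  shows "G \<cong>\<^sub>g induced H A \<longleftrightarrow> (\<exists>f. embedding f G H \<and> f ` verts G = A)"
  unfolding graph_iso_iff embedding_into_induced_iff[OF assms] by auto

lemma induced_sub_iff: "G \<le>\<^sub>g H \<longleftrightarrow> (\<exists>f. embedding f G H)"
  unfolding induced_sub_def by (metis graph_iso_induced_iff embedding_image_subset)

lemma induced_sub_refl: "G \<le>\<^sub>g G"
  using embedding_id induced_sub_iff by blast

lemma induced_sub_trans [trans]: "G \<le>\<^sub>g H \<Longrightarrow> H \<le>\<^sub>g K \<Longrightarrow> G \<le>\<^sub>g K"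
  by (meson embedding_comp induced_sub_iff)

lemma induced_induced_sub: "A \<subseteq> verts G \<Longrightarrow> induced G A \<le>\<^sub>g G"
  using embedding_id_induced induced_sub_iff by blast

lemma graph_iso_imp_induced_sub:
  assumes "G \<cong>\<^sub>g H"
  shows "G \<le>\<^sub>g H" "H \<le>\<^sub>g G"
  using assms embedding_inv_into unfolding graph_iso_iff induced_sub_iff by blast+

lemma fin_graph_iso:
  assumes "G \<cong>\<^sub>g H" "fin_graph G" "simple_graph H"
  shows "fin_graph H"
  using assms bij_betw_finite unfolding graph_iso_def fin_graph_def by blast

lemma contains_disjoint_iff:
  "contains_disjoint K G H \<longleftrightarrow>
     (\<exists>f g. embedding f G K \<and> embedding g H K \<and> f ` verts G \<inter> g ` verts H = {})"
proof
  assume "contains_disjoint K G H"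
  then obtain A B where AB: "A \<subseteq> verts K" "B \<subseteq> verts K" "A \<inter> B = {}"
    "G \<cong>\<^sub>g induced K A" "H \<cong>\<^sub>g induced K B"
    unfolding contains_disjoint_def by blast
  then obtain f g where "embedding f G K" "f ` verts G = A" "embedding g H K" "g ` verts H = B"
    unfolding graph_iso_induced_iff[OF AB(1)] graph_iso_induced_iff[OF AB(2)] by blast
  then show "\<exists>f g. embedding f G K \<and> embedding g H K \<and> f ` verts G \<inter> g ` verts H = {}"
    using AB(3) by blast
next
  assume "\<exists>f g. embedding f G K \<and> embedding g H K \<and> f ` verts G \<inter> g ` verts H = {}"
  then obtain f g where fg: "embedding f G K" "embedding g H K" "f ` verts G \<inter> g ` verts H = {}"
    by blast
  note sub = embedding_image_subset[OF fg(1)] embedding_image_subset[OF fg(2)]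
  have "G \<cong>\<^sub>g induced K (f ` verts G)" "H \<cong>\<^sub>g induced K (g ` verts H)"
    using fg unfolding graph_iso_induced_iff[OF sub(1)] graph_iso_induced_iff[OF sub(2)] by blast+
  then show "contains_disjoint K G H"
    unfolding contains_disjoint_def using sub fg(3) by blast
qed

lemma contains_disjoint_imp_induced_sub:
  assumes "contains_disjoint K G H"
  shows "G \<le>\<^sub>g K" "H \<le>\<^sub>g K"
  using assms by (auto simp: contains_disjoint_iff induced_sub_iff)

lemma contains_disjoint_mono:
  assumes "contains_disjoint K G H" "G' \<le>\<^sub>g G" "H' \<le>\<^sub>g H" "K \<le>\<^sub>g K'"
  shows "contains_disjoint K' G' H'"
proof -
  obtain f g where fg: "embedding f G K" "embedding g H K" "f ` verts G \<inter> g ` verts H = {}"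
    using assms(1) by (auto simp: contains_disjoint_iff)
  obtain a b c where abc: "embedding a G' G" "embedding b H' H" "embedding c K K'"
    using assms(2-4) by (auto simp: induced_sub_iff)
  have emb: "embedding (f \<circ> a) G' K" "embedding (g \<circ> b) H' K"
    using fg abc by (auto intro: embedding_comp)
  have "(f \<circ> a) ` verts G' \<inter> (g \<circ> b) ` verts H' = {}"
    using fg(3) embedding_image_subset[OF abc(1)] embedding_image_subset[OF abc(2)]
    unfolding image_comp[symmetric] by blast
  then have "(c \<circ> (f \<circ> a)) ` verts G' \<inter> (c \<circ> (g \<circ> b)) ` verts H' = {}"
    unfolding image_comp[of c, symmetric]
    by (intro embedding_image_disjoint[OF abc(3)] embedding_image_subset emb)
  moreover have "embedding (c \<circ> (f \<circ> a)) G' K'" "embedding (c \<circ> (g \<circ> b)) H' K'"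
    using emb abc(3) by (auto intro: embedding_comp)
  ultimately show ?thesis
    unfolding contains_disjoint_iff by blast
qed

lemma contains_disjoint_union_part:
  assumes "A \<inter> B = {}" "G \<cong>\<^sub>g induced K A" "H \<cong>\<^sub>g induced K B"
  shows "contains_disjoint (induced K (A \<union> B)) G H"
  unfolding contains_disjoint_def
  by (rule exI[of _ A], rule exI[of _ B]) (use assms in \<open>simp add: induced_induced\<close>)

lemma ex_two_copies_iff:
  fixes K L :: "'a graph"
  assumes "simple_graph K"
  shows "(\<exists>M \<in> 2\<circledast> L. M \<le>\<^sub>g K) \<longleftrightarrow> contains_disjoint K L L"
proof
  assume "\<exists>M \<in> 2\<circledast> L. M \<le>\<^sub>g K"
  then obtain M where M: "M \<in> 2\<circledast> L" "M \<le>\<^sub>g K"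
    by blast
  then have "contains_disjoint M L L"
    unfolding two_copies_def contains_disjoint_def by blast
  then show "contains_disjoint K L L"
    using M(2) by (rule contains_disjoint_mono[OF _ induced_sub_refl induced_sub_refl])
next
  assume "contains_disjoint K L L"
  then obtain A B where AB: "A \<subseteq> verts K" "B \<subseteq> verts K" "A \<inter> B = {}"
    "L \<cong>\<^sub>g induced K A" "L \<cong>\<^sub>g induced K B"
    unfolding contains_disjoint_def by blast
  have "induced K (A \<union> B) \<in> 2\<circledast> L"
    unfolding two_copies_def mem_Collect_eq
    using AB(3-5) simple_graph_induced[OF assms]
    by (intro conjI exI[of _ A] exI[of _ B]) (simp_all add: induced_induced)
  moreover have "induced K (A \<union> B) \<le>\<^sub>g K"
    using AB by (intro induced_induced_sub) simp
  ultimately show "\<exists>M \<in> 2\<circledast> L. M \<le>\<^sub>g K"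
    by blast
qed

subsection \<open>Relabelling\<close>

definition image_graph :: "('a \<Rightarrow> 'b) \<Rightarrow> 'a graph \<Rightarrow> 'b graph" where
  "image_graph f G = (f ` verts G, (`) f ` edges G)"

lemma verts_image_graph [simp]: "verts (image_graph f G) = f ` verts G"
  by (simp add: image_graph_def)

lemma
  assumes G: "simple_graph G" and inj: "inj_on f (verts G)"
  shows simple_graph_image_graph: "simple_graph (image_graph f G)"
    and embedding_image_graph: "embedding f G (image_graph f G)"
proof -
  have edge: "e \<subseteq> verts G" "card e = 2" if "e \<in> edges G" for e
    using G that by (auto simp: simple_graph_def)
  then show "simple_graph (image_graph f G)"
    using inj by (auto simp: simple_graph_def image_graph_def card_image inj_on_subset)
  have "{x, y} \<in> edges G"
    if "x \<in> verts G" "y \<in> verts G" "f ` {x, y} = f ` e" "e \<in> edges G" for x y e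
    using inj_on_image_eq_iff[OF inj, of "{x, y}" e] edge(1) that by simp
  then have "f ` {x, y} \<in> (`) f ` edges G \<longleftrightarrow> {x, y} \<in> edges G" if "x \<in> verts G" "y \<in> verts G" for x y
    using that by blast
  then show "embedding f G (image_graph f G)"
    using inj by (simp add: embedding_def image_graph_def)
qed

lemma ex_inj_on_countable_infinite:
  assumes "countable A" "infinite B"
  shows "\<exists>f. inj_on f A \<and> f ` A \<subseteq> B"
proof -
  have "A \<lesssim> (UNIV :: nat set)"
    using assms(1) by (auto simp: countable_def lepoll_def)
  also have "\<dots> \<lesssim> B"
    using assms(2) by (simp add: infinite_le_lepoll)
  finally show ?thesis
    by (simp add: lepoll_def)
qed

lemma ex_relabelling_extending:
  fixes X :: "'a graph" and K :: "'b graph"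
  assumes infinite_UNIV: "infinite (UNIV :: 'a set)" and X: "finite (verts X)" "X \<le>\<^sub>g K"
    and K: "simple_graph K" "countable (verts K)"
  shows "\<exists>Y :: 'a graph. simple_graph Y \<and> K \<cong>\<^sub>g Y \<and> embedding id X Y"
proof -
  obtain f where f: "embedding f X K"
    using X(2) induced_sub_iff by blast
  obtain a where a: "inj_on a (verts K)" "a ` verts K \<subseteq> - verts X"
    using ex_inj_on_countable_infinite[OF K(2), of "- verts X"] infinite_UNIV X(1)
    by (auto simp: finite_compl)
  define e where "e y = (if y \<in> f ` verts X then inv_into (verts X) f y else a y)" for y
  have e_f: "e (f x) = x" if "x \<in> verts X" for x
    using that embedding_inj_on[OF f] by (simp add: e_def)
  have e_other: "e y = a y" if "y \<notin> f ` verts X" for y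
    using that by (simp add: e_def)
  have "inj_on e (verts K)"
  proof (rule inj_onI)
    fix y z assume "y \<in> verts K" "z \<in> verts K" "e y = e z"
    then show "y = z"
      using e_f e_other a inj_onD[OF a(1)]
      by (cases "y \<in> f ` verts X"; cases "z \<in> f ` verts X") fastforce+
  qed
  note Y = simple_graph_image_graph[OF K(1) this] embedding_image_graph[OF K(1) this]
  have "embedding id X (image_graph e K)"
    by (rule embedding_cong[OF embedding_comp[OF f Y(2)]]) (simp add: e_f)
  moreover have "K \<cong>\<^sub>g image_graph e K"
    using Y(2) by (auto simp: graph_iso_iff)
  ultimately show ?thesis
    using Y(1) by blast
qed

corollary ex_relabelling:
  assumes "infinite (UNIV :: 'a set)" "simple_graph K" "countable (verts K)"
  shows "\<exists>Y :: 'a graph. simple_graph Y \<and> K \<cong>\<^sub>g Y"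
proof -
  have "({}, {}) \<le>\<^sub>g K"
    by (auto simp: induced_sub_iff embedding_def)
  then show ?thesis
    using ex_relabelling_extending[of "({}, {}) :: 'a graph" K] assms by auto
qed

subsection \<open>Ages\<close>

definition age :: "'a graph \<Rightarrow> nat graph set" where
  "age H = {G. fin_graph G \<and> G \<le>\<^sub>g H}"

lemma age_mono: "G \<le>\<^sub>g H \<Longrightarrow> age G \<subseteq> age H"
  unfolding age_def by (blast intro: induced_sub_trans)

lemma age_graph_iso: "G \<cong>\<^sub>g H \<Longrightarrow> age G = age H"
  by (intro equalityI age_mono graph_iso_imp_induced_sub)

lemma generating_graph_iff_age: "generating_graph P H \<longleftrightarrow> simple_graph H \<and> P = age H"
  by (simp add: generating_graph_def age_def)

lemma induced_hereditary_age: "induced_hereditary (age H)"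
  unfolding induced_hereditary_def age_def by (blast intro: induced_sub_trans)

lemma ex_age_graph_iso:
  assumes "fin_graph G" "G \<le>\<^sub>g H"
  shows "\<exists>F\<in>age H. G \<cong>\<^sub>g F"
proof -
  have "simple_graph G" "countable (verts G)"
    using assms(1) by (simp_all add: fin_graph_def countable_finite)
  then obtain F :: "nat graph" where F: "simple_graph F" "G \<cong>\<^sub>g F"
    using ex_relabelling[OF infinite_UNIV_nat] by blast
  have "F \<le>\<^sub>g H"
    using graph_iso_imp_induced_sub(2)[OF F(2)] assms(2) by (rule induced_sub_trans)
  then have "F \<in> age H"
    using fin_graph_iso[OF F(2) assms(1) F(1)] by (simp add: age_def)
  then show ?thesis
    using F(2) by blast
qed

lemma graph_propertyD:
  assumes "graph_property P" "G \<in> P"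
  shows "fin_graph G" "simple_graph G"
  using assms by (auto simp: graph_property_def fin_graph_def)

lemma generating_set_iff_age:
  assumes "graph_property P"
  shows "generating_set P \<G> \<longleftrightarrow> \<G> \<subseteq> P \<and> P = (\<Union>K\<in>\<G>. age K)"
  using graph_propertyD(1)[OF assms] unfolding generating_set_def age_def by blast

lemma generating_setE:
  assumes "generating_set P \<G>" "G \<in> P"
  obtains K where "K \<in> \<G>" "K \<in> P" "G \<le>\<^sub>g K"
  using assms unfolding generating_set_def by blast

lemma generating_set_rangeD: "generating_set P (range X) \<Longrightarrow> X n \<in> P"
  by (auto simp: generating_set_def)

lemma generating_set_self: "induced_hereditary P \<Longrightarrow> generating_set P P"
  unfolding generating_set_def induced_hereditary_def using induced_sub_refl by blast

lemma induced_hereditary_if_generating_set: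
  assumes "generating_set P \<G>"
  shows "induced_hereditary P"
  using assms unfolding induced_hereditary_def generating_set_def
  by (meson induced_sub_trans)

subsection \<open>Indiscompositivity by doubling\<close>

lemma indiscompositive_iff_doubling:
  "indiscompositive P \<longleftrightarrow>
     induced_hereditary P \<and> (\<forall>G\<in>P. \<forall>H\<in>P. \<exists>K\<in>P. contains_disjoint K G G \<and> H \<le>\<^sub>g K)"
    (is "_ \<longleftrightarrow> _ \<and> ?doubling")
proof (intro iffI conjI)
  assume P: "indiscompositive P"
  then show "induced_hereditary P"
    by (simp add: indiscompositive_def)
  show ?doubling
  proof (intro ballI)
    fix G H assume "G \<in> P" "H \<in> P"
    then obtain L K where LK: "L \<in> P" "contains_disjoint L G G" "K \<in> P" "contains_disjoint K L H"
      using P unfolding indiscompositive_def by metis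
    note LH = contains_disjoint_imp_induced_sub[OF LK(4)]
    have "contains_disjoint K G G"
      by (rule contains_disjoint_mono[OF LK(2) induced_sub_refl induced_sub_refl LH(1)])
    then show "\<exists>K\<in>P. contains_disjoint K G G \<and> H \<le>\<^sub>g K"
      using LK(3) LH(2) by blast
  qed
next
  assume P: "induced_hereditary P \<and> ?doubling"
  have "\<exists>K\<in>P. contains_disjoint K G H" if GH: "G \<in> P" "H \<in> P" for G H
  proof -
    obtain L K where LK: "L \<in> P" "contains_disjoint L G G" "H \<le>\<^sub>g L" "K \<in> P"
      "contains_disjoint K L L"
      using P GH by metis
    have "contains_disjoint K G H"
      using LK(5) contains_disjoint_imp_induced_sub(1)[OF LK(2)] LK(3) induced_sub_refl
      by (rule contains_disjoint_mono)
    then show ?thesis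
      using LK(4) by blast
  qed
  then show "indiscompositive P"
    using P by (simp add: indiscompositive_def)
qed

abbreviation self_doubling :: "'a graph \<Rightarrow> bool" where
  "self_doubling H \<equiv> contains_disjoint H H H"

lemma indiscompositive_age_if_self_doubling:
  assumes H: "simple_graph H" and doubling: "self_doubling H"
  shows "indiscompositive (age H)"
proof -
  have "\<exists>K\<in>age H. contains_disjoint K F G" if FG: "F \<in> age H" "G \<in> age H" for F G
  proof -
    have "contains_disjoint H F G"
      using FG by (intro contains_disjoint_mono[OF doubling _ _ induced_sub_refl])
        (simp_all add: age_def)
    then obtain A B where AB: "A \<subseteq> verts H" "B \<subseteq> verts H" "A \<inter> B = {}"
      "F \<cong>\<^sub>g induced H A" "G \<cong>\<^sub>g induced H B"
      unfolding contains_disjoint_def by blast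
    have "fin_graph (induced H A)" "fin_graph (induced H B)"
      using FG fin_graph_iso[OF AB(4)] fin_graph_iso[OF AB(5)] simple_graph_induced[OF H]
      by (simp_all add: age_def)
    then have "fin_graph (induced H (A \<union> B))"
      by (simp add: fin_graph_def simple_graph_induced[OF H])
    moreover have "induced H (A \<union> B) \<le>\<^sub>g H"
      using AB(1,2) by (intro induced_induced_sub) simp
    ultimately obtain K where K: "K \<in> age H" "induced H (A \<union> B) \<cong>\<^sub>g K"
      using ex_age_graph_iso by blast
    have "contains_disjoint K F G"
      using contains_disjoint_union_part[OF AB(3-5)] induced_sub_refl induced_sub_refl
        graph_iso_imp_induced_sub(1)[OF K(2)]
      by (rule contains_disjoint_mono)
    then show ?thesis
      using K(1) by blast
  qed
  then show ?thesis
    by (simp add: indiscompositive_def induced_hereditary_age)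
qed

lemma generating_set_containing_some:
  assumes P: "graph_property P" and indisc: "indiscompositive P"
    and L: "L \<in> P" and generating: "generating_set P \<G>"
  shows "generating_set P (containing_some \<G> (2\<circledast> L))"
proof -
  have "\<exists>K\<in>containing_some \<G> (2\<circledast> L). G \<le>\<^sub>g K" if G: "G \<in> P" for G
  proof -
    obtain K' where K': "K' \<in> P" "contains_disjoint K' L L" "G \<le>\<^sub>g K'"
      using indisc L G unfolding indiscompositive_iff_doubling by blast
    obtain K where K: "K \<in> \<G>" "K \<in> P" "K' \<le>\<^sub>g K"
      using generating_setE[OF generating K'(1)] .
    have "contains_disjoint K L L"
      by (rule contains_disjoint_mono[OF K'(2) induced_sub_refl induced_sub_refl K(3)])
    then have "K \<in> containing_some \<G> (2\<circledast> L)"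
      using K graph_propertyD(2)[OF P] by (simp add: containing_some_def ex_two_copies_iff)
    then show ?thesis
      using induced_sub_trans[OF K'(3) K(3)] by blast
  qed
  then show ?thesis
    using generating unfolding generating_set_def containing_some_def by blast
qed

lemma indiscompositive_if_generating_set_containing_some:
  assumes P: "graph_property P" and hereditary: "induced_hereditary P"
    and containing: "\<And>L. L \<in> P \<Longrightarrow> generating_set P (containing_some P (2\<circledast> L))"
  shows "indiscompositive P"
  unfolding indiscompositive_iff_doubling
proof (intro conjI ballI hereditary)
  fix G H assume "G \<in> P" "H \<in> P"
  then obtain K where K: "K \<in> containing_some P (2\<circledast> G)" "K \<in> P" "H \<le>\<^sub>g K"
    using generating_setE[OF containing] by metis
  then have "contains_disjoint K G G"
    by (simp add: containing_some_def flip: ex_two_copies_iff[OF graph_propertyD(2)[OF P K(2)]])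
  then show "\<exists>K\<in>P. contains_disjoint K G G \<and> H \<le>\<^sub>g K"
    using K(2,3) by blast
qed

theorem indiscompositive_iff_generating_set_containing_some:
  assumes P: "graph_property P"
  shows "indiscompositive P \<longleftrightarrow>
    (\<exists>\<G>. generating_set P \<G>) \<and>
    (\<forall>L\<in>P. \<forall>\<G>. generating_set P \<G> \<longrightarrow> generating_set P (containing_some \<G> (2\<circledast> L)))"
    (is "_ \<longleftrightarrow> ?ex \<and> ?all")
proof (intro iffI conjI ballI allI impI)
  assume indisc: "indiscompositive P"
  then have "generating_set P P"
    by (simp add: indiscompositive_def generating_set_self)
  then show ?ex
    by blast
  show "generating_set P (containing_some \<G> (2\<circledast> L))" if "L \<in> P" "generating_set P \<G>" for L \<G>
    using that by (rule generating_set_containing_some[OF P indisc])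
next
  assume generating: "?ex \<and> ?all"
  then have hereditary: "induced_hereditary P"
    using induced_hereditary_if_generating_set by blast
  then have "generating_set P (containing_some P (2\<circledast> L))" if "L \<in> P" for L
    using generating generating_set_self that by blast
  then show "indiscompositive P"
    by (rule indiscompositive_if_generating_set_containing_some[OF P hereditary])
qed

subsection \<open>Chains\<close>

lemma countable_fin_graphs: "countable {G :: 'a :: countable graph. fin_graph G}"
proof (rule countable_subset)
  show "{G :: 'a graph. fin_graph G} \<subseteq> Fpow UNIV \<times> Fpow (Fpow UNIV)"
  proof
    fix G :: "'a graph" assume "G \<in> {G. fin_graph G}"
    then have fin: "finite (verts G)" and E: "edges G \<subseteq> Pow (verts G)"
      by (auto simp: fin_graph_def simple_graph_def)
    have "finite (edges G)"
      using fin E by (meson finite_Pow_iff finite_subset)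
    moreover have "edges G \<subseteq> Fpow UNIV"
      using fin E by (auto simp: Fpow_def intro: finite_subset)
    ultimately show "G \<in> Fpow UNIV \<times> Fpow (Fpow UNIV)"
      using fin by (simp add: mem_Times_iff Fpow_def)
  qed
  show "countable (Fpow UNIV \<times> Fpow (Fpow UNIV) :: 'a graph set)"
    by (intro countable_SIGMA countable_Fpow countableI_type)
qed

lemma ex_doubling_chain:
  assumes P: "graph_property P" and indisc: "indiscompositive P"
  obtains X where "generating_set P (range X)" "\<And>n. contains_disjoint (X (Suc n)) (X n) (X n)"
proof -
  have nonempty: "P \<noteq> {}"
    using P by (simp add: graph_property_def)
  have "countable P"
    by (rule countable_subset[OF _ countable_fin_graphs]) (use graph_propertyD(1)[OF P] in blast)
  then obtain F :: "nat \<Rightarrow> nat graph" where F: "P = range F"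
    using nonempty uncountable_def by blast
  have "\<exists>X. \<forall>n. X n \<in> P \<and> (contains_disjoint (X (Suc n)) (X n) (X n) \<and> F n \<le>\<^sub>g X (Suc n))"
  proof (rule dependent_nat_choice)
    show "\<exists>G. G \<in> P"
      using nonempty by blast
  next
    fix G n assume G: "G \<in> P"
    have "F n \<in> P"
      using F by blast
    then show "\<exists>K. K \<in> P \<and> (contains_disjoint K G G \<and> F n \<le>\<^sub>g K)"
      using indisc G unfolding indiscompositive_iff_doubling by blast
  qed
  then obtain X where X: "\<And>n. X n \<in> P" "\<And>n. contains_disjoint (X (Suc n)) (X n) (X n)"
    "\<And>n. F n \<le>\<^sub>g X (Suc n)"
    by blast
  have "generating_set P (range X)"
    using indisc X(1,3) F by (auto simp: generating_set_hereditary indiscompositive_def)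
  then show ?thesis
    using X(2) by (rule that)
qed

lemma indiscompositive_if_doubling_chain:
  assumes generating: "generating_set P (range X)"
    and increasing: "\<And>n. X n \<le>\<^sub>g X (Suc n)"
    and doubling: "\<And>n. contains_disjoint (X (Suc n)) (X n) (X n)"
  shows "indiscompositive P"
  unfolding indiscompositive_iff_doubling
proof (intro conjI ballI)
  show "induced_hereditary P"
    using generating by (rule induced_hereditary_if_generating_set)
  have chain: "X m \<le>\<^sub>g X n" if "m \<le> n" for m n
    using that
  proof (rule transitive_stepwise_le)
    show "X i \<le>\<^sub>g X k" if "X i \<le>\<^sub>g X j" "X j \<le>\<^sub>g X k" for i j k
      using that by (rule induced_sub_trans)
  qed (rule induced_sub_refl increasing)+
  fix G H assume GH: "G \<in> P" "H \<in> P"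
  obtain i where i: "G \<le>\<^sub>g X i"
    using generating_setE[OF generating GH(1)] by blast
  obtain j where j: "H \<le>\<^sub>g X j"
    using generating_setE[OF generating GH(2)] by blast
  define m where "m = max i j"
  have "G \<le>\<^sub>g X m"
    using i by (rule induced_sub_trans) (rule chain, simp add: m_def)
  then have "contains_disjoint (X (Suc m)) G G"
    by (intro contains_disjoint_mono[OF doubling _ _ induced_sub_refl])
  moreover have "H \<le>\<^sub>g X (Suc m)"
    using j by (rule induced_sub_trans) (rule chain, simp add: m_def)
  moreover have "X (Suc m) \<in> P"
    using generating by (rule generating_set_rangeD)
  ultimately show "\<exists>K\<in>P. contains_disjoint K G G \<and> H \<le>\<^sub>g K"
    by blast
qed

theorem indiscompositive_iff_doubling_chain:
  assumes P: "graph_property P"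
  shows "indiscompositive P \<longleftrightarrow>
    (\<exists>G :: nat \<Rightarrow> nat graph. generating_set P (range G) \<and> (\<forall>i. G i \<le>\<^sub>g G (Suc i)) \<and>
       (\<forall>i. \<exists>M \<in> 2\<circledast> (G i). M \<le>\<^sub>g G (Suc i)))"
    (is "_ \<longleftrightarrow> ?chain")
proof -
  have two_copies_iff:
    "(\<exists>M \<in> 2\<circledast> (G i). M \<le>\<^sub>g G (Suc i)) \<longleftrightarrow> contains_disjoint (G (Suc i)) (G i) (G i)"
    if "generating_set P (range G)" for G i
    by (intro ex_two_copies_iff graph_propertyD(2)[OF P] generating_set_rangeD[OF that])
  show ?thesis
  proof
    assume "indiscompositive P"
    then obtain X where X: "generating_set P (range X)"
      "\<And>n. contains_disjoint (X (Suc n)) (X n) (X n)"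
      using ex_doubling_chain[OF P] by blast
    then show ?chain
      using contains_disjoint_imp_induced_sub(1)[OF X(2)]
      by (intro exI[of _ X]) (simp add: two_copies_iff)
  next
    assume ?chain
    then obtain X :: "nat \<Rightarrow> nat graph" where X: "generating_set P (range X)"
      "\<And>n. X n \<le>\<^sub>g X (Suc n)" "\<And>n. \<exists>M \<in> 2\<circledast> (X n). M \<le>\<^sub>g X (Suc n)"
      by blast
    then show "indiscompositive P"
      by (intro indiscompositive_if_doubling_chain[of P X]) (simp_all flip: two_copies_iff)
  qed
qed

definition chain_limit :: "(nat \<Rightarrow> 'a graph) \<Rightarrow> 'a graph" where
  "chain_limit X = (\<Union>n. verts (X n), \<Union>n. edges (X n))"

lemma chain_limit_simps [simp]:
  "verts (chain_limit X) = (\<Union>n. verts (X n))" "edges (chain_limit X) = (\<Union>n. edges (X n))"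
  by (simp_all add: chain_limit_def)

context
  fixes X :: "nat \<Rightarrow> 'a graph"
  assumes simple: "\<And>n. simple_graph (X n)" and nested: "\<And>n. embedding id (X n) (X (Suc n))"
begin

lemma simple_graph_chain_limit: "simple_graph (chain_limit X)"
  unfolding simple_graph_def
proof
  fix e assume "e \<in> edges (chain_limit X)"
  then obtain n where "e \<in> edges (X n)"
    by auto
  then show "e \<subseteq> verts (chain_limit X) \<and> card e = 2"
    using simple[of n] by (auto simp: simple_graph_def)
qed

lemma embedding_id_nested:
  assumes "m \<le> n"
  shows "embedding id (X m) (X n)"
  using assms
proof (rule transitive_stepwise_le)
  show "embedding id (X i) (X k)" if "embedding id (X i) (X j)" "embedding id (X j) (X k)" for i j k
    using that by (rule embedding_id_trans)
qed (rule embedding_id nested)+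

lemma embedding_id_chain_limit: "embedding id (X n) (chain_limit X)"
  unfolding embedding_id_iff
proof (intro conjI ballI iffI)
  show "verts (X n) \<subseteq> verts (chain_limit X)"
    by auto
next
  fix x y assume "{x, y} \<in> edges (X n)"
  then show "{x, y} \<in> edges (chain_limit X)"
    by auto
next
  fix x y assume xy: "x \<in> verts (X n)" "y \<in> verts (X n)" "{x, y} \<in> edges (chain_limit X)"
  then obtain m where m: "{x, y} \<in> edges (X m)"
    by auto
  then have "x \<in> verts (X m)" "y \<in> verts (X m)"
    using simple[of m] by (auto simp: simple_graph_def)
  then have "{x, y} \<in> edges (X (max m n))"
    using m embedding_id_nested[of m "max m n"] by (simp add: embedding_id_iff)
  then show "{x, y} \<in> edges (X n)"
    using xy embedding_id_nested[of n "max m n"] by (simp add: embedding_id_iff)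
qed

lemma age_chain_limit: "age (chain_limit X) = (\<Union>n. age (X n))"
proof
  have "X n \<le>\<^sub>g chain_limit X" for n
    using embedding_id_chain_limit induced_sub_iff by blast
  then show "(\<Union>n. age (X n)) \<subseteq> age (chain_limit X)"
    by (intro UN_least age_mono)
  show "age (chain_limit X) \<subseteq> (\<Union>n. age (X n))"
  proof
    fix G assume "G \<in> age (chain_limit X)"
    then obtain f where G: "fin_graph G" and f: "embedding f G (chain_limit X)"
      by (auto simp: age_def induced_sub_iff)
    have "\<forall>\<^sub>F n in sequentially. f v \<in> verts (X n)" if v: "v \<in> verts G" for v
    proof -
      obtain m where "f v \<in> verts (X m)"
        using embedding_image_subset[OF f] v by auto
      then have "f v \<in> verts (X n)" if "m \<le> n" for n
        using embedding_id_nested[OF that] by (auto simp: embedding_id_iff)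
      then show ?thesis
        by (auto simp: eventually_sequentially)
    qed
    then have "\<forall>\<^sub>F n in sequentially. \<forall>v\<in>verts G. f v \<in> verts (X n)"
      using G by (intro eventually_ball_finite) (simp_all add: fin_graph_def)
    then obtain n where n: "f ` verts G \<subseteq> verts (X n)"
      by (auto simp: eventually_sequentially)
    have "embedding f G (X n)"
      using embedding_id_chain_limit f n by (rule embedding_restrict_codomain)
    then show "G \<in> (\<Union>n. age (X n))"
      using G by (auto simp: age_def induced_sub_iff)
  qed
qed

end

lemma ex_nested_chain:
  fixes X :: "nat \<Rightarrow> 'a graph"
  assumes infinite_UNIV: "infinite (UNIV :: 'b set)"
    and fin: "\<And>n. fin_graph (X n)" and increasing: "\<And>n. X n \<le>\<^sub>g X (Suc n)"
  shows "\<exists>Y :: nat \<Rightarrow> 'b graph.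
    \<forall>n. (simple_graph (Y n) \<and> X n \<cong>\<^sub>g Y n) \<and> embedding id (Y n) (Y (Suc n))"
proof (rule dependent_nat_choice)
  have X: "simple_graph (X n)" "countable (verts (X n))" for n
    using fin by (simp_all add: fin_graph_def countable_finite)
  show "\<exists>Y :: 'b graph. simple_graph Y \<and> X 0 \<cong>\<^sub>g Y"
    using infinite_UNIV X by (rule ex_relabelling)
  fix Y :: "'b graph" and n assume Y: "simple_graph Y \<and> X n \<cong>\<^sub>g Y"
  then have "finite (verts Y)"
    using fin_graph_iso[of "X n" Y] fin[of n] by (simp add: fin_graph_def)
  moreover have "Y \<le>\<^sub>g X (Suc n)"
    using Y graph_iso_imp_induced_sub(2) increasing induced_sub_trans by blast
  ultimately show "\<exists>Y'. (simple_graph Y' \<and> X (Suc n) \<cong>\<^sub>g Y') \<and> embedding id Y Y'"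
    using ex_relabelling_extending[OF infinite_UNIV _ _ X] by blast
qed

lemma ex_generating_graph_if_chain:
  assumes P: "graph_property P" and generating: "generating_set P (range X)"
    and increasing: "\<And>n. X n \<le>\<^sub>g X (Suc n)"
  shows "\<exists>U :: nat graph. generating_graph P U"
proof -
  have "fin_graph (X n)" for n
    by (intro graph_propertyD(1)[OF P] generating_set_rangeD[OF generating])
  then obtain Y :: "nat \<Rightarrow> nat graph" where Y: "\<And>n. simple_graph (Y n)" "\<And>n. X n \<cong>\<^sub>g Y n"
    "\<And>n. embedding id (Y n) (Y (Suc n))"
    using ex_nested_chain[OF infinite_UNIV_nat, of X] increasing by blast
  have "P = (\<Union>n. age (X n))"
    using generating by (auto simp: generating_set_iff_age[OF P])
  also have "\<dots> = (\<Union>n. age (Y n))"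
    using age_graph_iso[OF Y(2)] by simp
  also have "\<dots> = age (chain_limit Y)"
    using age_chain_limit[of Y, OF Y(1,3)] by simp
  finally show ?thesis
    using simple_graph_chain_limit[of Y, OF Y(1,3)] generating_graph_iff_age by blast
qed

subsection \<open>Indiscernible copies\<close>

definition indiscernible_copies :: "'a graph \<Rightarrow> ('a \<times> 'a) set \<Rightarrow> ('a \<times> 'i :: linorder) graph" where
  "indiscernible_copies U R =
     (verts U \<times> UNIV,
      {{(s, i), (t, j)} | s t i j. s \<in> verts U \<and> t \<in> verts U \<and>
         (i = j \<and> {s, t} \<in> edges U \<or> i < j \<and> (s, t) \<in> R)})"

lemma verts_indiscernible_copies [simp]: "verts (indiscernible_copies U R) = verts U \<times> UNIV"
  by (simp add: indiscernible_copies_def)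

lemma edge_indiscernible_copies:
  assumes "s \<in> verts U" "t \<in> verts U"
  shows "{(s, i), (t, j)} \<in> edges (indiscernible_copies U R) \<longleftrightarrow>
    (if i = j then {s, t} \<in> edges U else if i < j then (s, t) \<in> R else (t, s) \<in> R)"
proof -
  have "{(s, i), (t, j)} \<in> edges (indiscernible_copies U R) \<longleftrightarrow>
      i = j \<and> {s, t} \<in> edges U \<or> i < j \<and> (s, t) \<in> R \<or> j < i \<and> (t, s) \<in> R"
    using assms unfolding indiscernible_copies_def snd_conv mem_Collect_eq doubleton_eq_iff
    by (auto simp: insert_commute)
  then show ?thesis
    by auto
qed

lemma simple_graph_indiscernible_copies:
  assumes "simple_graph U"
  shows "simple_graph (indiscernible_copies U R)"
proof -
  have "s \<noteq> t" if "{s, t} \<in> edges U" for s t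
    using assms that by (auto simp: simple_graph_def)
  then show ?thesis
    unfolding simple_graph_def indiscernible_copies_def by (auto simp: card_insert_if)
qed

lemma embedding_indiscernible_copiesI:
  fixes b :: "'i :: linorder \<Rightarrow> 'a \<Rightarrow> 'b"
  assumes emb: "\<And>i. embedding (b i) U H" and disj: "disjoint_family (\<lambda>i. b i ` verts U)"
    and cross: "\<And>i j s t. i < j \<Longrightarrow> s \<in> verts U \<Longrightarrow> t \<in> verts U \<Longrightarrow>
      {b i s, b j t} \<in> edges H \<longleftrightarrow> (s, t) \<in> R"
  shows "embedding (\<lambda>(s, i). b i s) (indiscernible_copies U R) H"
  unfolding embedding_def verts_indiscernible_copies
proof (intro conjI ballI)
  show "inj_on (\<lambda>(s, i). b i s) (verts U \<times> UNIV)"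
  proof (rule inj_onI, clarify)
    fix s i t j assume eq: "s \<in> verts U" "t \<in> verts U" "b i s = b j t"
    then have "i = j"
      using disjoint_family_onD[OF disj, of i j] by blast
    then show "s = t \<and> i = j"
      using eq embedding_inj_on[OF emb] by (auto dest: inj_onD)
  qed
  show "(\<lambda>(s, i). b i s) ` (verts U \<times> UNIV) \<subseteq> verts H"
    using embedding_image_subset[OF emb] by auto
  fix x y assume "x \<in> verts U \<times> (UNIV :: 'i set)" "y \<in> verts U \<times> (UNIV :: 'i set)"
  then obtain s i t j where xy: "x = (s, i)" "y = (t, j)" and st: "s \<in> verts U" "t \<in> verts U"
    by (metis SigmaE)
  have "{b i s, b j t} \<in> edges H \<longleftrightarrow>
      (if i = j then {s, t} \<in> edges U else if i < j then (s, t) \<in> R else (t, s) \<in> R)"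
    using st cross[of i j s t] cross[of j i t s] embedding_edge_iff[OF emb st, of i]
    by (cases i j rule: linorder_cases) (auto simp: insert_commute)
  then show "{x, y} \<in> edges (indiscernible_copies U R) \<longleftrightarrow>
      {case x of (s, i) \<Rightarrow> b i s, case y of (s, i) \<Rightarrow> b i s} \<in> edges H"
    by (simp add: xy edge_indiscernible_copies[OF st])
qed

lemma embedding_indiscernible_copy: "embedding (\<lambda>s. (s, i)) U (indiscernible_copies U R)"
  by (auto simp: embedding_def edge_indiscernible_copies inj_on_def)

lemma embedding_id_indiscernible_copies_mono:
  assumes "embedding id G U"
  shows "embedding id (indiscernible_copies G R) (indiscernible_copies U R)"
proof -
  have sub: "verts G \<subseteq> verts U"
    using assms by (simp add: embedding_id_iff)
  have "embedding (\<lambda>(s, i). (s, i)) (indiscernible_copies G R) (indiscernible_copies U R)"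
  proof (rule embedding_indiscernible_copiesI)
    show "embedding (\<lambda>s. (s, i)) G (indiscernible_copies U R)" for i
      using embedding_comp[OF assms embedding_indiscernible_copy] by simp
    show "disjoint_family (\<lambda>i. (\<lambda>s. (s, i)) ` verts G)"
      by (auto simp: disjoint_family_on_def)
  qed (use sub in \<open>auto simp: edge_indiscernible_copies subset_iff\<close>)
  then show ?thesis
    by (simp add: id_def)
qed

lemma induced_sub_indiscernible_copies: "U \<le>\<^sub>g indiscernible_copies U R"
  using embedding_indiscernible_copy induced_sub_iff by blast

lemma embedding_indiscernible_copies_reindex:
  assumes "strict_mono e"
  shows "embedding (\<lambda>(s, i). (s, e i)) (indiscernible_copies U R) (indiscernible_copies U R)"
proof (rule embedding_indiscernible_copiesI)
  show "disjoint_family (\<lambda>i. (\<lambda>s. (s, e i)) ` verts U)"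
    using strict_mono_eq[OF assms] by (auto simp: disjoint_family_on_def)
qed (auto simp: embedding_indiscernible_copy edge_indiscernible_copies
    strict_mono_less[OF assms] strict_mono_eq[OF assms])

lemma age_indiscernible_copies_subset:
  fixes U :: "'a graph" and R :: "('a \<times> 'a) set"
  defines "H \<equiv> \<lambda>G. indiscernible_copies G R :: ('a \<times> 'i :: linorder) graph"
  assumes part: "\<And>T. finite T \<Longrightarrow> T \<subseteq> verts U \<Longrightarrow> H (induced U T) \<le>\<^sub>g K"
  shows "age (H U) \<subseteq> age K"
proof
  fix G assume "G \<in> age (H U)"
  then obtain f where G: "fin_graph G" and f: "embedding f G (H U)"
    unfolding age_def induced_sub_iff by blast
  define T where "T = fst ` f ` verts G"
  have T: "finite T" "T \<subseteq> verts U"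
    using G embedding_image_subset[OF f] by (auto simp: T_def fin_graph_def H_def)
  have "embedding id (H (induced U T)) (H U)"
    unfolding H_def using embedding_id_induced[OF T(2)]
    by (rule embedding_id_indiscernible_copies_mono)
  moreover have "f ` verts G \<subseteq> verts (H (induced U T))"
    using subset_fst_snd[of "f ` verts G"] by (auto simp: T_def H_def)
  ultimately have "embedding f G (H (induced U T))"
    by (rule embedding_restrict_codomain[OF _ f])
  then have "G \<le>\<^sub>g H (induced U T)"
    unfolding induced_sub_iff by blast
  also have "\<dots> \<le>\<^sub>g K"
    using T by (rule part)
  finally show "G \<in> age K"
    using G by (simp add: age_def)
qed

definition eventually_indiscernible ::
    "('a \<times> 'a) set \<Rightarrow> (nat \<Rightarrow> 'a \<Rightarrow> 'b) \<Rightarrow> (nat \<Rightarrow> 'a set) \<Rightarrow> 'a graph \<Rightarrow> 'b graph \<Rightarrow> bool" where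
  "eventually_indiscernible R b S U K \<longleftrightarrow>
     (\<forall>i. embedding (b i) (induced U (S i)) K) \<and> disjoint_family (\<lambda>i. b i ` S i) \<and>
     (\<forall>s\<in>verts U. \<forall>\<^sub>F i in sequentially. s \<in> S i) \<and>
     (\<forall>s\<in>verts U. \<forall>t\<in>verts U.
        \<forall>\<^sub>F i in sequentially. \<forall>j>i. {b i s, b j t} \<in> edges K \<longleftrightarrow> (s, t) \<in> R)"

lemma induced_sub_if_eventually_indiscernible:
  fixes U :: "'a graph"
  assumes b: "eventually_indiscernible R b S U K" and T: "finite T" "T \<subseteq> verts U"
  shows "(indiscernible_copies (induced U T) R :: ('a \<times> nat) graph) \<le>\<^sub>g K"
    (is "?copies \<le>\<^sub>g K")
proof -
  have embedding: "embedding (b i) (induced U (S i)) K"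
    and disjoint: "disjoint_family (\<lambda>i. b i ` S i)"
    and S: "\<forall>s\<in>verts U. \<forall>\<^sub>F i in sequentially. s \<in> S i"
    and R: "\<forall>s\<in>verts U. \<forall>t\<in>verts U.
      \<forall>\<^sub>F i in sequentially. \<forall>j>i. {b i s, b j t} \<in> edges K \<longleftrightarrow> (s, t) \<in> R" for i
    using b by (simp_all add: eventually_indiscernible_def)
  have "\<forall>\<^sub>F i in sequentially. \<forall>s\<in>T. s \<in> S i"
    by (intro eventually_ball_finite ballI T(1) bspec[OF S subsetD[OF T(2)]])
  moreover have "\<forall>\<^sub>F i in sequentially. \<forall>s\<in>T. \<forall>t\<in>T. \<forall>j>i. {b i s, b j t} \<in> edges K \<longleftrightarrow> (s, t) \<in> R"
    by (intro eventually_ball_finite ballI T(1)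
        bspec[OF bspec[OF R subsetD[OF T(2)]] subsetD[OF T(2)]])
  ultimately have "\<forall>\<^sub>F i in sequentially. (\<forall>s\<in>T. s \<in> S i) \<and>
      (\<forall>s\<in>T. \<forall>t\<in>T. \<forall>j>i. {b i s, b j t} \<in> edges K \<longleftrightarrow> (s, t) \<in> R)"
    by (rule eventually_conj)
  then obtain m where m: "\<forall>i\<ge>m. (\<forall>s\<in>T. s \<in> S i) \<and>
      (\<forall>s\<in>T. \<forall>t\<in>T. \<forall>j>i. {b i s, b j t} \<in> edges K \<longleftrightarrow> (s, t) \<in> R)"
    unfolding eventually_sequentially ..
  have T_subset: "T \<subseteq> S (m + i)" for i
    using m by auto
  have "embedding (\<lambda>(s, i). b (m + i) s) ?copies K"
  proof (rule embedding_indiscernible_copiesI)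
    show "embedding (b (m + i)) (induced U T) K" for i
      using embedding T_subset by (rule embedding_induced_mono)
    have "disjoint_family (\<lambda>i. b (m + i) ` S (m + i))"
      using disjoint by (simp add: disjoint_family_on_def)
    then show "disjoint_family (\<lambda>i. b (m + i) ` verts (induced U T))"
      by (rule disjoint_family_subset) (simp add: T_subset image_mono)
  qed (use m in simp)
  then show ?thesis
    unfolding induced_sub_iff by blast
qed

lemma self_doubling_indiscernible_copies:
  "self_doubling (indiscernible_copies U R :: ('a \<times> nat) graph)"
proof -
  define H :: "('a \<times> nat) graph" where "H = indiscernible_copies U R"
  have "strict_mono (\<lambda>i :: nat. 2 * i)" "strict_mono (\<lambda>i :: nat. Suc (2 * i))"
    by (simp_all add: strict_mono_def)
  moreover have "(\<lambda>(s, i). (s, 2 * i)) ` verts H \<inter> (\<lambda>(s, i). (s, Suc (2 * i))) ` verts H = {}"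
    by (auto, presburger)
  ultimately have "self_doubling H"
    unfolding contains_disjoint_iff H_def
    using embedding_indiscernible_copies_reindex by blast
  then show ?thesis
    by (simp add: H_def)
qed

subsection \<open>Ramsey's theorem and disjoint copies inside a generating graph\<close>

definition homogeneous :: "(nat \<Rightarrow> nat \<Rightarrow> bool) \<Rightarrow> (nat \<Rightarrow> nat) \<Rightarrow> bool" where
  "homogeneous Q s \<longleftrightarrow> (\<exists>c. \<forall>i j. i < j \<longrightarrow> Q (s i) (s j) \<longleftrightarrow> c)"

lemma homogeneous_subseq:
  assumes "strict_mono r" "homogeneous Q s"
  shows "homogeneous Q (s \<circ> r)"
proof -
  obtain c where "\<And>i j. i < j \<Longrightarrow> Q (s i) (s j) \<longleftrightarrow> c"
    using assms(2) unfolding homogeneous_def by blast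
  then show ?thesis
    using strict_monoD[OF assms(1)] by (auto simp: homogeneous_def)
qed

lemma ex_homogeneous_subseq: "\<exists>r. strict_mono r \<and> homogeneous Q r"
proof -
  define f where "f p = (if Q (Min p) (Max p) then 1 else 0 :: nat)" for p
  have "\<forall>x\<in>UNIV. \<forall>y\<in>UNIV. x \<noteq> y \<longrightarrow> f {x, y} < 2"
    by (simp add: f_def)
  from Ramsey2[OF infinite_UNIV_nat this]
  obtain Y t where Y: "infinite Y" "\<forall>x\<in>Y. \<forall>y\<in>Y. x \<noteq> y \<longrightarrow> f {x, y} = t"
    by blast
  define r where "r = enumerate Y"
  have mono: "strict_mono r"
    using Y(1) by (simp add: r_def strict_mono_enumerate)
  have "Q (r i) (r j) \<longleftrightarrow> t = 1" if "i < j" for i j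
  proof -
    have "r i < r j" "r i \<in> Y" "r j \<in> Y"
      using strict_monoD[OF mono that] enumerate_in_set[OF Y(1)] by (simp_all add: r_def)
    then have "t = f {r i, r j}"
      using Y(2) by simp
    also have "\<dots> = (if Q (r i) (r j) then 1 else 0)"
      using \<open>r i < r j\<close> by (simp add: f_def min_absorb1 max_absorb2)
    finally show ?thesis
      by simp
  qed
  with mono show ?thesis
    unfolding homogeneous_def by blast
qed

lemma ex_eventually_homogeneous_subseq:
  fixes Q :: "'a \<Rightarrow> nat \<Rightarrow> nat \<Rightarrow> bool"
  assumes "countable A"
  obtains d :: "nat \<Rightarrow> nat" and c where "strict_mono d"
    "\<And>x. x \<in> A \<Longrightarrow> \<forall>\<^sub>F i in sequentially. \<forall>j>i. Q x (d i) (d j) \<longleftrightarrow> c x"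
proof -
  interpret subseqs "\<lambda>n. homogeneous (Q (from_nat_into A n))"
  proof
    fix n and s :: "nat \<Rightarrow> nat"
    show "\<exists>r. strict_mono r \<and> homogeneous (Q (from_nat_into A n)) (s \<circ> r)"
      using ex_homogeneous_subseq[of "\<lambda>i j. Q (from_nat_into A n) (s i) (s j)"]
      by (simp add: homogeneous_def)
  qed
  have "\<exists>c. \<forall>\<^sub>F i in sequentially. \<forall>j>i. Q x (diagseq i) (diagseq j) \<longleftrightarrow> c" if x: "x \<in> A" for x
  proof -
    define k where "k = to_nat_on A x"
    have "homogeneous (Q x) (diagseq \<circ> ((+) (Suc k)))"
      using diagseq_holds[OF homogeneous_subseq, of k] x assms by (simp add: k_def)
    then obtain c where
      c: "\<And>i j. i < j \<Longrightarrow> Q x (diagseq (Suc k + i)) (diagseq (Suc k + j)) \<longleftrightarrow> c"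
      by (auto simp: homogeneous_def)
    have "Q x (diagseq i) (diagseq j) \<longleftrightarrow> c" if "Suc k \<le> i" "i < j" for i j
      using c[of "i - Suc k" "j - Suc k"] that by (simp add: diff_less_mono)
    then show ?thesis
      by (intro exI[of _ c] eventually_sequentiallyI[of "Suc k"]) simp
  qed
  then have "\<forall>x\<in>A. \<exists>c. \<forall>\<^sub>F i in sequentially. \<forall>j>i. Q x (diagseq i) (diagseq j) \<longleftrightarrow> c"
    by blast
  from bchoice[OF this] obtain c where
    c: "\<forall>x\<in>A. \<forall>\<^sub>F i in sequentially. \<forall>j>i. Q x (diagseq i) (diagseq j) \<longleftrightarrow> c x" ..
  show ?thesis
    using subseq_diagseq bspec[OF c] by (rule that)
qed

lemma ex_embedding_age_avoiding:
  fixes U :: "'a graph"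
  assumes indisc: "indiscompositive (age U)" and "finite F" and "X \<in> age U"
  shows "\<exists>f. embedding f X U \<and> f ` verts X \<inter> F = {}"
  using assms(2,3)
proof (induction F arbitrary: X)
  case empty
  then show ?case
    by (simp add: age_def induced_sub_iff)
next
  case (insert u F)
  obtain K where K: "K \<in> age U" "contains_disjoint K X X"
    using indisc insert.prems unfolding indiscompositive_def by blast
  obtain g where g: "embedding g K U" "g ` verts K \<inter> F = {}"
    using insert.IH[OF K(1)] by blast
  obtain p q where pq: "embedding p X K" "embedding q X K" "p ` verts X \<inter> q ` verts X = {}"
    using K(2) unfolding contains_disjoint_iff by blast
  have avoid: "(g \<circ> h) ` verts X \<inter> F = {}" if "embedding h X K" for h
    using g(2) embedding_image_subset[OF that] by auto
  have "g ` p ` verts X \<inter> g ` q ` verts X = {}"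
    by (intro embedding_image_disjoint[OF g(1)] embedding_image_subset pq)
  then have "u \<notin> (g \<circ> p) ` verts X \<or> u \<notin> (g \<circ> q) ` verts X"
    by (auto simp: image_comp)
  then show ?case
    using avoid pq(1,2) embedding_comp[OF _ g(1)] by (metis Int_insert_right_if0)
qed

lemma ex_embedding_avoiding:
  fixes U :: "'a graph" and X :: "'b graph"
  assumes indisc: "indiscompositive (age U)" and X: "fin_graph X" "X \<le>\<^sub>g U" and F: "finite F"
  shows "\<exists>f. embedding f X U \<and> f ` verts X \<inter> F = {}"
proof -
  obtain Y where Y: "Y \<in> age U" "X \<cong>\<^sub>g Y"
    using ex_age_graph_iso[OF X] by blast
  obtain e where e: "embedding e X Y"
    using Y(2) by (auto simp: graph_iso_iff)
  obtain f where f: "embedding f Y U" "f ` verts Y \<inter> F = {}"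
    using ex_embedding_age_avoiding[OF indisc F Y(1)] by blast
  have "embedding (f \<circ> e) X U"
    using e f(1) by (rule embedding_comp)
  moreover have "(f \<circ> e) ` verts X \<inter> F = {}"
    using f(2) embedding_image_subset[OF e] by auto
  ultimately show ?thesis
    by blast
qed

lemma ex_disjoint_embeddings:
  fixes U :: "'a graph" and X :: "nat \<Rightarrow> 'b graph"
  assumes indisc: "indiscompositive (age U)" and X: "\<And>n. fin_graph (X n)" "\<And>n. X n \<le>\<^sub>g U"
  obtains a where "\<And>n. embedding (a n) (X n) U" "disjoint_family (\<lambda>n. a n ` verts (X n))"
proof -
  define used where "used a n = (\<Union>m<n. a m ` verts (X m))" for a :: "nat \<Rightarrow> 'b \<Rightarrow> 'a" and n
  have "\<exists>a. \<forall>n. embedding (a n) (X n) U \<and> a n ` verts (X n) \<inter> used a n = {}"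
  proof (rule dependent_wellorder_choice)
    fix a n
    have "finite (used a n)"
      using X(1) by (simp add: used_def fin_graph_def)
    then show "\<exists>f. embedding f (X n) U \<and> f ` verts (X n) \<inter> used a n = {}"
      by (rule ex_embedding_avoiding[OF indisc X])
  qed (simp add: used_def)
  then obtain a where a: "\<And>n. embedding (a n) (X n) U" "\<And>n. a n ` verts (X n) \<inter> used a n = {}"
    by blast
  have "a m ` verts (X m) \<inter> a n ` verts (X n) = {}" if "m < n" for m n
    using a(2)[of n] that by (auto simp: used_def)
  then have "disjoint_family (\<lambda>n. a n ` verts (X n))"
    unfolding disjoint_family_on_def by (metis Int_commute linorder_neqE_nat)
  with a(1) show ?thesis
    by (rule that)
qed

lemma ex_eventually_indiscernible:
  fixes U :: "'a graph"
  assumes U: "simple_graph U" "countable (verts U)" and indisc: "indiscompositive (age U)"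
  shows "\<exists>R b S. eventually_indiscernible R b S U U"
proof -
  define S where "S n = {v \<in> verts U. to_nat_on (verts U) v < n}" for n
  have "finite (S n)" for n
    by (rule inj_on_finite[of "to_nat_on (verts U)" _ "{..<n}"])
      (use inj_on_to_nat_on[OF U(2)] in \<open>auto simp: S_def inj_on_def\<close>)
  then have "fin_graph (induced U (S n))" "induced U (S n) \<le>\<^sub>g U" for n
    using U(1) by (auto simp: fin_graph_def simple_graph_induced S_def intro: induced_induced_sub)
  then obtain a where a: "\<And>n. embedding (a n) (induced U (S n)) U" "disjoint_family (\<lambda>n. a n ` S n)"
    using ex_disjoint_embeddings[OF indisc, of "\<lambda>n. induced U (S n)"] by auto
  obtain d c where d: "strict_mono d" and c: "\<And>p. p \<in> verts U \<times> verts U \<Longrightarrow>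
      \<forall>\<^sub>F i in sequentially. \<forall>j>i. {a (d i) (fst p), a (d j) (snd p)} \<in> edges U \<longleftrightarrow> c p"
    using ex_eventually_homogeneous_subseq[where A = "verts U \<times> verts U" and
        Q = "\<lambda>p m n. {a m (fst p), a n (snd p)} \<in> edges U"] U(2) by auto
  have "eventually_indiscernible (Collect c) (a \<circ> d) (S \<circ> d) U U"
    unfolding eventually_indiscernible_def
  proof (intro conjI allI ballI)
    show "embedding ((a \<circ> d) i) (induced U ((S \<circ> d) i)) U" for i
      by (simp add: a(1))
    show "disjoint_family (\<lambda>i. (a \<circ> d) i ` (S \<circ> d) i)"
      using a(2) strict_mono_eq[OF d] by (simp add: disjoint_family_on_def)
    fix s assume s: "s \<in> verts U"
    then have "\<forall>\<^sub>F n in sequentially. s \<in> S n"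
      by (simp add: S_def eventually_gt_at_top)
    then show "\<forall>\<^sub>F i in sequentially. s \<in> (S \<circ> d) i"
      using eventually_subseq[OF d] by simp
    fix t assume "t \<in> verts U"
    then show "\<forall>\<^sub>F i in sequentially. \<forall>j>i.
        {(a \<circ> d) i s, (a \<circ> d) j t} \<in> edges U \<longleftrightarrow> (s, t) \<in> Collect c"
      using c[of "(s, t)"] s by simp
  qed
  then show ?thesis
    by blast
qed

lemma ex_age_indiscernible_copies:
  fixes U :: "'a graph"
  assumes U: "simple_graph U" "countable (verts U)" and indisc: "indiscompositive (age U)"
  shows "\<exists>R. age (indiscernible_copies U R :: ('a \<times> nat) graph) = age U"
proof -
  obtain R b S where "eventually_indiscernible R b S U U"
    using ex_eventually_indiscernible[OF U indisc] by blast
  then have "(indiscernible_copies (induced U T) R :: ('a \<times> nat) graph) \<le>\<^sub>g U"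
    if "finite T" "T \<subseteq> verts U" for T
    using that by (rule induced_sub_if_eventually_indiscernible)
  then have "age (indiscernible_copies U R :: ('a \<times> nat) graph) \<subseteq> age U"
    by (rule age_indiscernible_copies_subset)
  moreover have "age U \<subseteq> age (indiscernible_copies U R :: ('a \<times> nat) graph)"
    by (intro age_mono induced_sub_indiscernible_copies)
  ultimately show ?thesis
    by blast
qed

lemma ex_self_doubling_generating_graph:
  fixes U :: "'b graph"
  assumes infinite_UNIV: "infinite (UNIV :: 'a set)" and indisc: "indiscompositive P"
    and generating: "generating_graph P U" and countable_verts: "countable (verts U)"
  shows "\<exists>H :: 'a graph. generating_graph P H \<and> U \<le>\<^sub>g H \<and> self_doubling H"
proof -
  have U: "simple_graph U" "P = age U"
    using generating by (simp_all add: generating_graph_iff_age)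
  obtain R where R: "age (indiscernible_copies U R :: ('b \<times> nat) graph) = age U"
    using ex_age_indiscernible_copies U countable_verts indisc by blast
  define C :: "('b \<times> nat) graph" where "C = indiscernible_copies U R"
  have C: "simple_graph C" "countable (verts C)" "age C = P" "U \<le>\<^sub>g C" "self_doubling C"
    using U countable_verts R
    by (simp_all add: C_def simple_graph_indiscernible_copies self_doubling_indiscernible_copies
        induced_sub_indiscernible_copies)
  obtain H :: "'a graph" where H: "simple_graph H" "C \<cong>\<^sub>g H"
    using ex_relabelling[OF infinite_UNIV C(1,2)] by blast
  note CH = graph_iso_imp_induced_sub[OF H(2)]
  have "generating_graph P H"
    using H(1) C(3) age_graph_iso[OF H(2)] by (simp add: generating_graph_iff_age)
  moreover have "U \<le>\<^sub>g H"
    using C(4) CH(1) by (rule induced_sub_trans)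
  moreover have "self_doubling H"
    using C(5) CH(2,2,1) by (rule contains_disjoint_mono)
  ultimately show ?thesis
    by blast
qed

theorem indiscompositive_iff_self_doubling_generating_graph:
  assumes P: "graph_property P" and infinite_UNIV: "infinite (UNIV :: 'a set)"
  shows "indiscompositive P \<longleftrightarrow>
    (\<exists>H :: 'a graph. generating_graph P H \<and> (\<exists>M \<in> 2\<circledast> H. M \<le>\<^sub>g H)) \<and>
    (\<forall>G :: 'a graph. generating_graph P G \<and> countable (verts G) \<longrightarrow>
       (\<exists>H :: 'a graph. generating_graph P H \<and> G \<le>\<^sub>g H \<and> (\<exists>M \<in> 2\<circledast> H. M \<le>\<^sub>g H)))"
    (is "_ \<longleftrightarrow> ?ex \<and> ?above")
proof -
  have two_copies_iff: "(\<exists>M \<in> 2\<circledast> H. M \<le>\<^sub>g H) \<longleftrightarrow> self_doubling H"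
    if "generating_graph P H" for H :: "'a graph"
    using that by (intro ex_two_copies_iff) (simp add: generating_graph_def)
  show ?thesis
  proof (intro iffI conjI)
    assume indisc: "indiscompositive P"
    obtain X where "generating_set P (range X)" "\<And>n. contains_disjoint (X (Suc n)) (X n) (X n)"
      using ex_doubling_chain[OF P indisc] by blast
    then obtain U :: "nat graph" where U: "generating_graph P U"
      using ex_generating_graph_if_chain[OF P] contains_disjoint_imp_induced_sub(1) by metis
    show ?ex
      using ex_self_doubling_generating_graph[OF infinite_UNIV indisc U countableI_type]
        two_copies_iff by blast
    show ?above
      using ex_self_doubling_generating_graph[OF infinite_UNIV indisc] two_copies_iff by blast
  next
    assume "?ex \<and> ?above"
    then obtain H :: "'a graph" where H: "generating_graph P H" "\<exists>M \<in> 2\<circledast> H. M \<le>\<^sub>g H"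
      by blast
    then have "self_doubling H"
      by (simp add: two_copies_iff)
    then show "indiscompositive P"
      using H(1) by (simp add: generating_graph_iff_age indiscompositive_age_if_self_doubling)
  qed
qed

theorem theorem4p2:
  fixes P :: "nat graph set"
  assumes "graph_property P"
    and "infinite (UNIV :: 'a set)"
  shows
    "(indiscompositive P \<longleftrightarrow>
        (\<exists>\<G>. generating_set P \<G>) \<and>
        (\<forall>L\<in>P. \<forall>\<G>. generating_set P \<G> \<longrightarrow> generating_set P (containing_some \<G> (2\<circledast> L))))
   \<and> (indiscompositive P \<longleftrightarrow>
        (\<exists>G :: nat \<Rightarrow> nat graph.
           generating_set P (range G) \<and>
           (\<forall>i. G i \<le>\<^sub>g G (Suc i)) \<and>
           (\<forall>i. \<exists>M \<in> 2\<circledast> (G i). M \<le>\<^sub>g G (Suc i))))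
   \<and> (indiscompositive P \<longleftrightarrow>
        (\<exists>H :: 'a graph. generating_graph P H \<and> (\<exists>M \<in> 2\<circledast> H. M \<le>\<^sub>g H)) \<and>
        (\<forall>G :: 'a graph. generating_graph P G \<and> countable (verts G) \<longrightarrow>
           (\<exists>H :: 'a graph. generating_graph P H \<and> G \<le>\<^sub>g H \<and> (\<exists>M \<in> 2\<circledast> H. M \<le>\<^sub>g H))))"
  using indiscompositive_iff_generating_set_containing_some[OF assms(1)]
    indiscompositive_iff_doubling_chain[OF assms(1)]
    indiscompositive_iff_self_doubling_generating_graph[OF assms]
  by (intro conjI)

end
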